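(* Let $d, r, n_1,\dots,n_d$ be positive integers, let $\mathcal{I} = \{1,\dots,n_1\}\times\cdots\times\{1,\dots,n_d\}$, let $\mathcal{X} = (x_i)_{i\in\mathcal{I}}$ be a real tensor of size $n_1\times n_2\times\cdots\times n_d$, and let $\Omega\subseteq\mathcal{I}$ be the nonempty set of indices of known elements of $\mathcal{X}$. Let $f:\mathbb{R}\times\mathbb{R}\to\mathbb{R}$, $(x,m)\mapsto f(x,m)$, be a function that is continuously differentiable with respect to its second argument. Define the tensor $\mathcal{W}=(w_i)_{i\in\mathcal{I}}$ by $w_i = 1/|\Omega|$ if $i\in\Omega$ and $w_i=0$ if $i\notin\Omega$. For $k\in\{1,\dots,d\}$ let $\mathbf{A}_k$ be a real matrix of size $n_k\times r$, and let $\mathcal{M} = [\![\mathbf{A}_1,\dots,\mathbf{A}_d]\!]$ be the Kruskal tensor with these factor matrices. Then the objective function $\frac{1}{|\Omega|}\sum_{i\in\Omega} f(x_i,m_i)$ of the problem of minimizing over the factor matrices $\mathbf{A}_1,\dots,\mathbf{A}_d$ can be rewritten as $$F(\mathcal{M};\mathcal{X},\mathcal{W}) = \sum_{i\in\mathcal{I}} w_i\, f(x_i,m_i), \qquad \mathcal{M} = [\![\mathbf{A}_1,\dots,\mathbf{A}_d]\!],$$ and for each mode $k\in\{1,\dots,d\}$ the first partial derivative of $F$ (regarded as a function of $\mathbf{A}_1,\dots,\mathbf{A}_d$) with respect to $\mathbf{A}_k$ is $$\frac{\partial F}{\partial \mathbf{A}_k} = \mathbf{Y}_{(k)}\mathbf{Z}_k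 \in \mathbb{R}^{n_k\times r},$$ where $\mathbf{Z}_k = \mathbf{A}_d\odot\cdots\odot\mathbf{A}_{k+1}\odot\mathbf{A}_{k-1}\odot\cdots\odot\mathbf{A}_1$ and $\mathbf{Y}_{(k)}$ is the mode-$k$ unfolding of the tensor $\mathcal{Y}=(y_i)_{i\in\mathcal{I}}$ defined by $$y_i = w_i\,\frac{\partial f}{\partial m}(x_i,m_i)\quad\text{for all } i\in\mathcal{I}.$$
   Context: Notation. A multiindex is $i=(i_1,\dots,i_d)\in\mathcal{I}$, and $x_i = x(i_1,\dots,i_d)$. Entries of $\mathcal{X}$ outside $\Omega$ are unknown and may be regarded as arbitrary real numbers (they are multiplied by the weight $0$). Kruskal tensor: for matrices $\mathbf{A}_k\in\mathbb{R}^{n_k\times r}$ with entries $a_k(i_k,j)$, the tensor $\mathcal{M}=[\![\mathbf{A}_1,\dots,\mathbf{A}_d]\!]$ of size $n_1\times\cdots\times n_d$ has entries $m_i = \sum_{j=1}^r a_1(i_1,j)\,a_2(i_2,j)\cdots a_d(i_d,j)$. Khatri-Rao product: for $\mathbf{A}\in\mathbb{R}^{m\times p}$ and $\mathbf{B}\in\mathbb{R}^{n\times p}$, $\mathbf{A}\odot\mathbf{B}\in\mathbb{R}^{mn\times p}$ is the columnwise Kronecker product, i.e. its entry in row $(s-1)n+t$ and column $j$ is $a_{sj}b_{tj}$ for $1\le s\le m$, $1\le t\le n$. (An empty Khatri-Rao product, occurring only when $d=1$, is the $1\times r$ matrix of ones.) Mode-$k$ unfolding: the mode-$k$ unfolding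 $\mathbf{Y}_{(k)}$ of a tensor $\mathcal{Y}$ of size $n_1\times\cdots\times n_d$ is the matrix of size $n_k\times\prod_{\ell\neq k}n_\ell$ in which the tensor entry with index $(i_1,\dots,i_d)$ is placed in position $(i_k,i_k')$, where $i_k' = 1+\sum_{\ell=1}^{k-1}(i_\ell-1)n'_\ell+\sum_{\ell=k+1}^{d}(i_\ell-1)(n'_\ell/n_k)$, with $n'_1=1$ and $n'_\ell=\prod_{q=1}^{\ell-1}n_q$ for $\ell>1$. Derivatives: "$f$ is continuously differentiable with respect to its second argument" means that for each $x$ the map $m\mapsto f(x,m)$ is continuously differentiable, and $\frac{\partial f}{\partial m}$ denotes the derivative in the second argument. For a real-valued function $F$ of a matrix $\mathbf{A}\in\mathbb{R}^{n\times r}$, $\partial F/\partial\mathbf{A}$ is the $n\times r$ matrix with entries $\partial F/\partial a_{ij}$. *)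

theory Defs
  imports "HOL-Analysis.Analysis" "Jordan_Normal_Form.Matrix"
begin

text \<open>
  Conventions: modes and matrix/tensor indices start at 0, as matrix indices do in
  \<^theory>\<open>Jordan_Normal_Form.Matrix\<close>.  A tensor of order \<open>d\<close> and size
  \<open>n 0 \<times> \<dots> \<times> n (d - 1)\<close> is a function on multiindices \<open>i\<close>, where \<open>i l < n l\<close> is the index
  in mode \<open>l\<close>; its values outside \<open>multiindices d n\<close> are irrelevant.
\<close>

type_synonym tensor = "(nat \<Rightarrow> nat) \<Rightarrow> real"

definition multiindices :: "nat \<Rightarrow> (nat \<Rightarrow> nat) \<Rightarrow> (nat \<Rightarrow> nat) set" where
  "multiindices d n = (\<Pi>\<^sub>E l\<in>{..<d}. {..<n l})"

definition kruskal :: "nat \<Rightarrow> nat \<Rightarrow> (nat \<Rightarrow> real mat) \<Rightarrow> tensor" where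
  "kruskal d r A = (\<lambda>i. \<Sum>j<r. \<Prod>l<d. A l $$ (i l, j))"

definition khatri_rao :: "real mat \<Rightarrow> real mat \<Rightarrow> real mat" where
  "khatri_rao A B = mat (dim_row A * dim_row B) (dim_col A)
     (\<lambda>(p, j). A $$ (p div dim_row B, j) * B $$ (p mod dim_row B, j))"

text \<open>
  The Khatri-Rao product of \<open>A (d - 1), \<dots>, A (k + 1), A (k - 1), \<dots>, A 0\<close> in this order.  The
  all-ones row that ends the fold is the empty product; it is a right unit for \<open>khatri_rao\<close>.
\<close>

definition khatri_rao_except :: "nat \<Rightarrow> nat \<Rightarrow> (nat \<Rightarrow> real mat) \<Rightarrow> nat \<Rightarrow> real mat" where
  "khatri_rao_except d r A k =
     foldr khatri_rao (map A (rev [Suc k..<d] @ rev [0..<k])) (mat 1 r (\<lambda>_. 1))"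

definition unfold_col :: "nat \<Rightarrow> (nat \<Rightarrow> nat) \<Rightarrow> nat \<Rightarrow> (nat \<Rightarrow> nat) \<Rightarrow> nat" where
  "unfold_col d n k i =
     (\<Sum>l\<in>{..<k}. i l * (\<Prod>q<l. n q)) + (\<Sum>l\<in>{k<..<d}. i l * ((\<Prod>q<l. n q) div n k))"

text \<open>
  The tensor entry at \<open>i\<close> is placed in position \<open>(i k, unfold_col d n k i)\<close>;
  the lemma \<open>unfolding_index\<close> below confirms that \<open>THE\<close> is well defined.
\<close>

definition unfolding_mat :: "nat \<Rightarrow> (nat \<Rightarrow> nat) \<Rightarrow> nat \<Rightarrow> tensor \<Rightarrow> real mat" where
  "unfolding_mat d n k Y = mat (n k) (\<Prod>l\<in>{..<d} - {k}. n l)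
     (\<lambda>(p, c). Y (THE i. i \<in> multiindices d n \<and> i k = p \<and> unfold_col d n k i = c))"

definition weight :: "(nat \<Rightarrow> nat) set \<Rightarrow> tensor" where
  "weight \<Omega> = (\<lambda>i. if i \<in> \<Omega> then 1 / real (card \<Omega>) else 0)"

definition objective ::
  "nat \<Rightarrow> (nat \<Rightarrow> nat) \<Rightarrow> (real \<Rightarrow> real \<Rightarrow> real) \<Rightarrow> tensor \<Rightarrow> tensor \<Rightarrow> tensor \<Rightarrow> real" where
  "objective d n f M X W = (\<Sum>i\<in>multiindices d n. W i * f (X i) (M i))"

text \<open>
  \<open>G\<close> is the matrix of the entrywise partial derivatives of \<open>F\<close> at \<open>A\<close>; the relation includes
  their existence.
\<close>

definition has_matrix_partials :: "(real mat \<Rightarrow> real) \<Rightarrow> real mat \<Rightarrow> real mat \<Rightarrow> bool" where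
  "has_matrix_partials F A G \<longleftrightarrow>
     G \<in> carrier_mat (dim_row A) (dim_col A) \<and>
     (\<forall>p<dim_row A. \<forall>j<dim_col A.
        ((\<lambda>t. F (A |\<^sub>m (p, j) \<mapsto> t)) has_real_derivative G $$ (p, j)) (at (A $$ (p, j))))"

lemma khatri_rao_except_carrier:
  assumes "k < d" "\<forall>l<d. A l \<in> carrier_mat (n l) r"
  shows "khatri_rao_except d r A k \<in> carrier_mat (\<Prod>l\<in>{..<d} - {k}. n l) r"
proof -
  have fold: "foldr khatri_rao (map A ls) (mat 1 r (\<lambda>_. 1)) \<in> carrier_mat (\<Prod>l\<in>set ls. n l) r"
    if "distinct ls" "\<forall>l\<in>set ls. l < d" for ls
    using that assms(2) by (induction ls) (auto simp: khatri_rao_def)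
  have "set (rev [Suc k..<d] @ rev [0..<k]) = {..<d} - {k}"
    using assms(1) by auto
  with fold[of "rev [Suc k..<d] @ rev [0..<k]"] assms(1) show ?thesis
    unfolding khatri_rao_except_def by auto
qed

lemma mixed_radix_less:
  fixes i m :: "nat \<Rightarrow> nat"
  assumes "\<And>l. l < d \<Longrightarrow> i l < m l"
  shows "(\<Sum>l<d. i l * (\<Prod>q<l. m q)) < (\<Prod>q<d. m q)"
  using assms
proof (induction d)
  case (Suc d)
  let ?P = "\<Prod>q<d. m q"
  have "(\<Sum>l<Suc d. i l * (\<Prod>q<l. m q)) < ?P + i d * ?P"
    using Suc by simp
  also have "\<dots> = Suc (i d) * ?P" by simp
  also have "\<dots> \<le> m d * ?P"
    using Suc.prems[of d] by (intro mult_le_mono1) simp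
  finally show ?case by (simp add: mult.commute)
qed simp

lemma mixed_radix_inj:
  fixes i j m :: "nat \<Rightarrow> nat"
  assumes "\<And>l. l < d \<Longrightarrow> i l < m l" "\<And>l. l < d \<Longrightarrow> j l < m l"
    and "(\<Sum>l<d. i l * (\<Prod>q<l. m q)) = (\<Sum>l<d. j l * (\<Prod>q<l. m q))"
  shows "\<forall>l<d. i l = j l"
  using assms
proof (induction d)
  case (Suc d)
  let ?P = "\<Prod>q<d. m q"
  let ?S = "\<lambda>i. \<Sum>l<d. i l * (\<Prod>q<l. m q)"
  have lt: "?S i < ?P" "?S j < ?P"
    using Suc.prems by (auto intro!: mixed_radix_less)
  have eq: "?S i + i d * ?P = ?S j + j d * ?P"
    using Suc.prems(3) by simp
  have "a = (s + a * P) div P" if "s < P" for a s P :: nat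
    using that by simp
  from this[OF lt(1)] this[OF lt(2)]
  have "i d = (?S i + i d * ?P) div ?P" "j d = (?S j + j d * ?P) div ?P"
    by blast+
  with eq have "i d = j d" by simp
  with eq have "?S i = ?S j" by simp
  with Suc \<open>i d = j d\<close> show ?case by (auto simp: less_Suc_eq)
qed simp

lemma unfold_col_mixed_radix:
  assumes "k < d" "0 < n k"
  shows "unfold_col d n k i = (\<Sum>l<d. (i(k := 0)) l * (\<Prod>q<l. (n(k := 1)) q))"
proof -
  have stride: "(\<Prod>q<l. (n(k := 1)) q) = (\<Prod>q<l. n q) div n k" if "k < l" for l
  proof -
    have "(\<Prod>q<l. n q) = n k * (\<Prod>q\<in>{..<l} - {k}. n q)"
      using that by (subst prod.remove[of _ k]) auto
    moreover have "(\<Prod>q<l. (n(k := 1)) q) = (\<Prod>q\<in>{..<l} - {k}. n q)"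
      using that by (subst prod.remove[of _ k]) auto
    ultimately show ?thesis using assms by simp
  qed
  have split: "{..<d} = {..<k} \<union> ({k} \<union> {k<..<d})" using assms by auto
  show ?thesis
    unfolding split unfold_col_def
    by (subst sum.union_disjoint; (subst sum.union_disjoint)?)
       (auto simp: stride[simplified] intro!: sum.cong arg_cong2[where f = "(+)"] prod.cong)
qed

lemma unfolding_index:
  assumes k: "k < d" and i: "i \<in> multiindices d n"
  shows "i k < n k" "unfold_col d n k i < (\<Prod>l\<in>{..<d} - {k}. n l)"
    "unfolding_mat d n k Y $$ (i k, unfold_col d n k i) = Y i"
proof -
  show ik: "i k < n k" using assms by (auto simp: multiindices_def)
  then have pos: "0 < n k" by simp
  have bnd: "(j(k := 0)) l < (n(k := 1)) l" if "j \<in> multiindices d n" "l < d" for j l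
    using that by (auto simp: multiindices_def)
  have "(\<Prod>q<d. (n(k := 1)) q) = (\<Prod>l\<in>{..<d} - {k}. n l)"
    using k by (subst prod.remove[of _ k]) auto
  with mixed_radix_less[of d "i(k := 0)" "n(k := 1)", OF bnd[OF i]]
  show col: "unfold_col d n k i < (\<Prod>l\<in>{..<d} - {k}. n l)"
    by (simp add: unfold_col_mixed_radix[OF k, of n, OF pos])
  have uniq: "j = i"
    if j: "j \<in> multiindices d n" and "j k = i k" "unfold_col d n k j = unfold_col d n k i" for j
  proof -
    have "\<forall>l<d. (j(k := 0)) l = (i(k := 0)) l"
      using that bnd[OF i] bnd[OF j]
      by (intro mixed_radix_inj[where m = "n(k := 1)"])
         (auto simp: unfold_col_mixed_radix[OF k, of n, OF pos])
    then have "j l = i l" if "l < d" for l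
      using that \<open>j k = i k\<close> by (cases "l = k") auto
    then show ?thesis
      using i j unfolding multiindices_def by (intro PiE_ext) auto
  qed
  have "(THE j. j \<in> multiindices d n \<and> j k = i k \<and> unfold_col d n k j = unfold_col d n k i) = i"
    using i uniq by (intro the_equality) auto
  then show "unfolding_mat d n k Y $$ (i k, unfold_col d n k i) = Y i"
    using ik col by (simp add: unfolding_mat_def)
qed

end

theory Submission
  imports Defs
begin

text \<open>
  Every entry \<open>m\<^sub>i\<close> of the Kruskal tensor is affine in each entry of \<open>A\<^sub>k\<close>: its derivative with
  respect to the entry \<open>(p, j)\<close> is \<open>\<Prod>\<^bsub>l \<noteq> k\<^esub> a\<^sub>l(i\<^sub>l, j)\<close> if \<open>i\<^sub>k = p\<close> and \<open>0\<close> otherwise.  This product is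
  the entry of the Khatri-Rao product in the row numbered by the unfolding column of \<open>i\<close>, because
  both are the mixed radix expansion of \<open>i\<close> with mode \<open>k\<close> left out.  So the chain rule gives a sum
  over the multiindices with \<open>i\<^sub>k = p\<close>, and the unfolding columns enumerate these bijectively.
\<close>

text \<open>The row is written with the row of \<open>B\<close> as its low digit, so a factor put in
  front of a fold supplies the most significant digit.\<close>

lemma khatri_rao_index:
  assumes "B \<in> carrier_mat s r" "s' < s" "a < dim_row A" "j < dim_col A"
  shows "khatri_rao A B $$ (s' + a * s, j) = A $$ (a, j) * B $$ (s', j)"
proof -
  have "s' + a * s < Suc a * s" using assms by simp
  also have "\<dots> \<le> dim_row A * s"
    using assms by (intro mult_le_mono1) simp
  finally have "s' + a * s < dim_row A * s" .
  then show ?thesis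
    using assms by (simp add: khatri_rao_def)
qed

text \<open>Induction on \<open>d\<close>: reversal puts the newest mode outermost in the fold,
  which makes it the leading digit. The updates \<open>n(k := 1)\<close> and
  \<open>i(k := 0)\<close> turn mode \<open>k\<close> into a digit that adds nothing, so one
  induction passes through \<open>k\<close>. The carrier part supplies the radix for the next
  digit.\<close>

lemma foldr_khatri_rao_index:
  assumes "\<forall>l<d. l \<noteq> k \<longrightarrow> A l \<in> carrier_mat (n l) r" "\<forall>l<d. l \<noteq> k \<longrightarrow> i l < n l" "j < r"
  defines "K \<equiv> foldr khatri_rao (map A (filter (\<lambda>l. l \<noteq> k) (rev [0..<d]))) (mat 1 r (\<lambda>_. 1))"
  shows "K \<in> carrier_mat (\<Prod>q<d. (n(k := 1)) q) r \<and>
    K $$ (\<Sum>l<d. (i(k := 0)) l * (\<Prod>q<l. (n(k := 1)) q), j) = (\<Prod>l\<in>{..<d} - {k}. A l $$ (i l, j))"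
  using assms(1,2) unfolding K_def
proof (induction d)
  case 0
  then show ?case using \<open>j < r\<close> by simp
next
  case (Suc d)
  let ?K = "foldr khatri_rao (map A (filter (\<lambda>l. l \<noteq> k) (rev [0..<d]))) (mat 1 r (\<lambda>_. 1))"
  let ?P = "\<Prod>q<d. (n(k := 1)) q"
  let ?c = "\<Sum>l<d. (i(k := 0)) l * (\<Prod>q<l. (n(k := 1)) q)"
  have K: "?K \<in> carrier_mat ?P r" "?K $$ (?c, j) = (\<Prod>l\<in>{..<d} - {k}. A l $$ (i l, j))"
    using Suc by auto
  show ?case
  proof (cases "d = k")
    case True
    \<comment> \<open>The filter drops mode \<open>k\<close>; its digit 0 and radix 1 leave the row
      number and the row count unchanged.\<close>
    then have "{..<Suc d} - {k} = {..<d} - {k}" by auto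
    with K True show ?thesis by simp
  next
    case False
    have c: "?c < ?P" using Suc.prems by (intro mixed_radix_less) auto
    have Ad: "A d \<in> carrier_mat (n d) r" "i d < n d" using Suc.prems False by auto
    have "{..<Suc d} - {k} = insert d ({..<d} - {k})" using False by auto
    moreover have "khatri_rao (A d) ?K $$ (?c + i d * ?P, j) = A d $$ (i d, j) * ?K $$ (?c, j)"
      using Ad \<open>j < r\<close> by (intro khatri_rao_index[OF K(1) c]) auto
    moreover have "khatri_rao (A d) ?K \<in> carrier_mat (?P * n d) r"
      using K(1) Ad by (auto simp: khatri_rao_def)
    ultimately show ?thesis using False K(2) by simp
  qed
qed

lemma khatri_rao_except_index:
  assumes k: "k < d" and A: "\<forall>l<d. A l \<in> carrier_mat (n l) r"
    and i: "i \<in> multiindices d n" and j: "j < r"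
  shows "khatri_rao_except d r A k $$ (unfold_col d n k i, j) = (\<Prod>l\<in>{..<d} - {k}. A l $$ (i l, j))"
proof -
  \<comment> \<open>Cutting the range at \<open>k\<close> identifies the filtered list with the two
    segments in \<open>khatri_rao_except\<close>.\<close>
  have "[0..<d] = [0..<k] @ k # [Suc k..<d]"
    using k upt_add_eq_append[of 0 k "d - k"] by (simp add: upt_conv_Cons)
  then have "filter (\<lambda>l. l \<noteq> k) (rev [0..<d]) = rev [Suc k..<d] @ rev [0..<k]"
    by (auto simp: filter_id_conv)
  moreover have "0 < n k" using unfolding_index(1)[OF k i] by simp
  moreover have "\<forall>l<d. i l < n l" using i by (auto simp: multiindices_def)
  ultimately show ?thesis
    using foldr_khatri_rao_index[of d k A n r i j] A j
    by (simp add: khatri_rao_except_def unfold_col_mixed_radix[OF k] del: fun_upd_apply)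
qed

text \<open>An injection into a finite set of the same cardinality is onto, so counting replaces the
  construction of an inverse by digit extraction.\<close>

lemma bij_betw_unfold_col:
  assumes k: "k < d" and p: "p < n k"
  shows "bij_betw (unfold_col d n k) {i \<in> multiindices d n. i k = p} {..<\<Prod>l\<in>{..<d} - {k}. n l}"
proof -
  let ?S = "{i \<in> multiindices d n. i k = p}"
  have inj: "inj_on (unfold_col d n k) ?S"
  proof (rule inj_onI)
    fix i j assume ij: "i \<in> ?S" "j \<in> ?S" "unfold_col d n k i = unfold_col d n k j"
    \<comment> \<open>The indicator tensor of \<open>i\<close>: since \<open>i\<close> and
      \<open>j\<close> share a position in its unfolding, its value at \<open>j\<close> is also 1,
      hence \<open>j = i\<close>.\<close>
    let ?Y = "\<lambda>x. if x = i then 1 else (0::real)"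
    have "?Y i = ?Y j"
      using unfolding_index(3)[OF k, of i n ?Y] unfolding_index(3)[OF k, of j n ?Y] ij by simp
    then show "i = j" by (simp split: if_splits)
  qed
  \<comment> \<open>As a product of finite sets, with a singleton in mode \<open>k\<close>, the
    slice can be counted by \<open>card_PiE\<close>.\<close>
  have "?S = (\<Pi>\<^sub>E l\<in>{..<d}. if l = k then {p} else {..<n l})"
  proof (intro equalityI subsetI)
    fix i assume "i \<in> ?S"
    then show "i \<in> (\<Pi>\<^sub>E l\<in>{..<d}. if l = k then {p} else {..<n l})"
      by (simp add: multiindices_def PiE_iff)
  next
    fix i assume "i \<in> (\<Pi>\<^sub>E l\<in>{..<d}. if l = k then {p} else {..<n l})"
    then have i: "i l \<in> (if l = k then {p} else {..<n l})" "i \<in> extensional {..<d}" if "l < d" for l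
      using that by (auto simp: PiE_iff)
    have "i k = p" using i(1)[OF k] by simp
    moreover have "i l < n l" if "l < d" for l
      using i(1)[OF that] p by (cases "l = k") auto
    ultimately show "i \<in> ?S" using i(2)[OF k] by (simp add: multiindices_def PiE_iff)
  qed
  then have "card ?S = (\<Prod>l<d. card (if l = k then {p} else {..<n l}))"
    by (simp add: card_PiE)
  also have "\<dots> = (\<Prod>l\<in>{..<d} - {k}. n l)"
    using k by (subst prod.remove[of _ k]) auto
  finally have "card (unfold_col d n k ` ?S) = card {..<\<Prod>l\<in>{..<d} - {k}. n l}"
    by (simp add: card_image[OF inj])
  moreover have "unfold_col d n k ` ?S \<subseteq> {..<\<Prod>l\<in>{..<d} - {k}. n l}"
    using unfolding_index(2)[OF k] by auto
  ultimately have "unfold_col d n k ` ?S = {..<\<Prod>l\<in>{..<d} - {k}. n l}"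
    by (intro card_subset_eq) auto
  with inj show ?thesis by (simp add: bij_betw_def)
qed

lemma unfolding_mult_khatri_rao_index:
  assumes k: "k < d" and A: "\<forall>l<d. A l \<in> carrier_mat (n l) r" and p: "p < n k" and j: "j < r"
  shows "(unfolding_mat d n k Y * khatri_rao_except d r A k) $$ (p, j) =
    (\<Sum>i | i \<in> multiindices d n \<and> i k = p. Y i * (\<Prod>l\<in>{..<d} - {k}. A l $$ (i l, j)))"
proof -
  let ?U = "unfolding_mat d n k Y" and ?Z = "khatri_rao_except d r A k"
  let ?P = "\<Prod>l\<in>{..<d} - {k}. n l"
  have "?Z \<in> carrier_mat ?P r" using khatri_rao_except_carrier[OF k A] .
  then have "(?U * ?Z) $$ (p, j) = (\<Sum>c<?P. ?U $$ (p, c) * ?Z $$ (c, j))"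
    using p j by (auto simp: unfolding_mat_def scalar_prod_def atLeast0LessThan)
  also have "\<dots> = (\<Sum>i | i \<in> multiindices d n \<and> i k = p.
      ?U $$ (p, unfold_col d n k i) * ?Z $$ (unfold_col d n k i, j))"
    \<comment> \<open>Each column number is the unfolding column of exactly one multiindex in the
      slice \<open>i k = p\<close>.\<close>
    by (rule sum.reindex_bij_betw[OF bij_betw_unfold_col[of k d p n, OF k p], symmetric])
  also have "\<dots> = (\<Sum>i | i \<in> multiindices d n \<and> i k = p. Y i * (\<Prod>l\<in>{..<d} - {k}. A l $$ (i l, j)))"
    using unfolding_index(3)[OF k] khatri_rao_except_index[OF k A _ j] by (intro sum.cong) auto
  finally show ?thesis .
qed

text \<open>Pulling the factor of mode \<open>k\<close> out of each product exhibits the entry as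
  linear in \<open>B\<close>, with coefficients free of \<open>B\<close>.\<close>

lemma kruskal_fun_upd:
  assumes "k < d"
  shows "kruskal d r (A(k := B)) i = (\<Sum>j<r. B $$ (i k, j) * (\<Prod>l\<in>{..<d} - {k}. A l $$ (i l, j)))"
  unfolding kruskal_def
proof (intro sum.cong refl)
  fix j
  show "(\<Prod>l<d. (A(k := B)) l $$ (i l, j)) = B $$ (i k, j) * (\<Prod>l\<in>{..<d} - {k}. A l $$ (i l, j))"
    using assms by (subst prod.remove[of _ k]) auto
qed

text \<open>The variable \<open>t\<close> occurs only in summand \<open>j\<close>, and there only
  when \<open>i\<close> selects row \<open>p\<close>. The dependence is affine, so the slope is the
  same at every \<open>x\<close>.\<close>

lemma has_real_derivative_kruskal:
  assumes k: "k < d" and A: "A k \<in> carrier_mat s r" and ik: "i k < s" and j: "j < r"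
  shows "((\<lambda>t. kruskal d r (A(k := A k |\<^sub>m (p, j) \<mapsto> t)) i) has_real_derivative
    (if i k = p then \<Prod>l\<in>{..<d} - {k}. A l $$ (i l, j) else 0)) (at x)"
proof -
  let ?c = "\<lambda>j. \<Prod>l\<in>{..<d} - {k}. A l $$ (i l, j)"
  have entry: "(A k |\<^sub>m (p, j) \<mapsto> t) $$ (i k, j') = (if i k = p \<and> j' = j then t else A k $$ (i k, j'))"
    if "j' < r" for j' t
    using that A ik by (auto simp: update_mat_def)
  have "((\<lambda>t. \<Sum>j'<r. (if i k = p \<and> j' = j then t else A k $$ (i k, j')) * ?c j') has_real_derivative
      (\<Sum>j'<r. if i k = p \<and> j' = j then ?c j' else 0)) (at x)"
    by (intro DERIV_sum) (auto intro!: derivative_eq_intros)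
  moreover have "(\<Sum>j'<r. if i k = p \<and> j' = j then ?c j' else 0) = (if i k = p then ?c j else 0)"
    using j by simp
  ultimately show ?thesis
    by (simp add: kruskal_fun_upd[OF k] entry del: fun_upd_apply)
qed

theorem theorem4p3:
  fixes d r :: nat and n :: "nat \<Rightarrow> nat" and X :: tensor and \<Omega> :: "(nat \<Rightarrow> nat) set"
    and f :: "real \<Rightarrow> real \<Rightarrow> real" and A :: "nat \<Rightarrow> real mat"
  assumes "0 < d" and "0 < r" and "\<forall>l<d. 0 < n l"
    and "\<Omega> \<subseteq> multiindices d n" and "\<Omega> \<noteq> {}"
    and "\<forall>x. f x C1_differentiable_on UNIV"
    and "\<forall>l<d. A l \<in> carrier_mat (n l) r"
  shows "(1 / real (card \<Omega>)) * (\<Sum>i\<in>\<Omega>. f (X i) (kruskal d r A i))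
           = objective d n f (kruskal d r A) X (weight \<Omega>)
       \<and> (\<forall>k<d.
           has_matrix_partials
             (\<lambda>B. objective d n f (kruskal d r (A(k := B))) X (weight \<Omega>)) (A k)
             (unfolding_mat d n k (\<lambda>i. weight \<Omega> i * deriv (f (X i)) (kruskal d r A i))
                * khatri_rao_except d r A k))"
proof (intro conjI allI impI)
  have fin: "finite (multiindices d n)" by (simp add: multiindices_def finite_PiE)
  show "(1 / real (card \<Omega>)) * (\<Sum>i\<in>\<Omega>. f (X i) (kruskal d r A i))
      = objective d n f (kruskal d r A) X (weight \<Omega>)"
    unfolding objective_def sum_distrib_left
    by (rule sum.mono_neutral_cong_left[OF fin assms(4)]) (auto simp: weight_def)
  fix k assume k: "k < d"
  let ?M = "kruskal d r A" and ?W = "weight \<Omega>"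
  let ?Y = "\<lambda>i. ?W i * deriv (f (X i)) (?M i)"
  let ?G = "unfolding_mat d n k ?Y * khatri_rao_except d r A k"
  have Ak: "A k \<in> carrier_mat (n k) r" using assms(7) k by blast
  have "?G \<in> carrier_mat (n k) r"
    using khatri_rao_except_carrier[OF k assms(7)] by (auto simp: unfolding_mat_def)
  moreover have "((\<lambda>t. objective d n f (kruskal d r (A(k := A k |\<^sub>m (p, j) \<mapsto> t))) X ?W)
      has_real_derivative ?G $$ (p, j)) (at (A k $$ (p, j)))" if p: "p < n k" and j: "j < r" for p j
  proof -
    let ?x = "A k $$ (p, j)"
    let ?m = "\<lambda>i t. kruskal d r (A(k := A k |\<^sub>m (p, j) \<mapsto> t)) i"
    let ?c = "\<lambda>i. \<Prod>l\<in>{..<d} - {k}. A l $$ (i l, j)"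
    \<comment> \<open>Writing the current entry back changes nothing, so the chain rule at
      \<open>?x\<close> evaluates the derivative of \<open>f\<close> at \<open>?M i\<close>.\<close>
    have "A k |\<^sub>m (p, j) \<mapsto> ?x = A k" by (auto simp: update_mat_def)
    then have m: "?m i ?x = ?M i" for i by simp
    have df: "(f x has_real_derivative deriv (f x) y) (at y)" for x y
    proof -
      \<comment> \<open>Differentiability ensures that \<open>deriv\<close> is a true derivative and
        not an arbitrary value of its choice operator.\<close>
      obtain D where "(f x has_vector_derivative D) (at y)"
        using assms(6) unfolding C1_differentiable_on_def by blast
      then have "(f x has_real_derivative D) (at y)"
        by (simp add: has_real_derivative_iff_has_vector_derivative)
      then show ?thesis using DERIV_imp_deriv by blast
    qed
    have "((\<lambda>t. f (X i) (?m i t)) has_real_derivative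
        deriv (f (X i)) (?M i) * (if i k = p then ?c i else 0)) (at ?x)"
      if i: "i \<in> multiindices d n" for i
      unfolding m[of i, symmetric]
      by (rule DERIV_chain2[where f = "f (X i)" and g = "?m i", OF df])
         (rule has_real_derivative_kruskal[of k d A "n k" r i j p ?x,
            OF k Ak unfolding_index(1)[OF k i] j])
    then have "((\<lambda>t. objective d n f (\<lambda>i. ?m i t) X ?W) has_real_derivative
        (\<Sum>i\<in>multiindices d n. ?W i * (deriv (f (X i)) (?M i) * (if i k = p then ?c i else 0))))
        (at ?x)"
      unfolding objective_def by (intro DERIV_sum DERIV_cmult)
    also have "(\<Sum>i\<in>multiindices d n. ?W i * (deriv (f (X i)) (?M i) * (if i k = p then ?c i else 0)))
        = (\<Sum>i\<in>multiindices d n. if i k = p then ?Y i * ?c i else 0)"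
      by (intro sum.cong) auto
    also have "\<dots> = (\<Sum>i | i \<in> multiindices d n \<and> i k = p. ?Y i * ?c i)"
      by (rule sum.inter_filter[OF fin, symmetric])
    also have "\<dots> = ?G $$ (p, j)"
      by (rule unfolding_mult_khatri_rao_index[OF k assms(7) p j, symmetric])
    finally show ?thesis .
  qed
  ultimately show "has_matrix_partials
      (\<lambda>B. objective d n f (kruskal d r (A(k := B))) X ?W) (A k) ?G"
    \<comment> \<open>The entries of \<open>?G\<close> stay folded to match the derivative
      established above.\<close>
    using Ak by (auto simp: has_matrix_partials_def simp del: index_mult_mat)
qed

end
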